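(* Let $s>0$ and assume that $f\in\mathcal{A}^s$. For $n\geq 2$ define the estimator $f_{\mathbf z}=f_{\mathbf z,\Lambda_{J^\star}}$, where $$J^\star=J^\star(n)=\min\Big\{j\in\mathbb{N}:\ 2^{j(1+2s)}\geq \tfrac{n}{\log n}\Big\}.$$ Then, given any $\beta>0$, there are a constant $\tilde c$ and a constant $C$ depending only on $M$ such that, for all $n\ge 2$, $$P^{\otimes n}\Big\{\|f-f_{\mathbf z}\|_{L^2(G_X)}>(\tilde c+|f|_{\mathcal{A}^s})\Big(\frac{\log n}{n}\Big)^{\frac{s}{2s+1}}\Big\}\leq C\,n^{-\beta}$$ and $$\mathbb{E}^{\otimes n}\Big\{\|f-f_{\mathbf z}\|^2_{L^2(G_X)}\Big\}\leq (C+|f|^2_{\mathcal{A}^s})\Big(\frac{\log n}{n}\Big)^{\frac{2s}{2s+1}}.$$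
   Context: **Model.** $\mathbf z=\{(X_i,Y_i)\}_{i=1}^n$ is an i.i.d. sample from a probability measure $P$ on $[0,1]\times[-M,M]$, with $M>0$. $P^{\otimes n}$ is the law of the sample and $\mathbb{E}^{\otimes n}$ the corresponding expectation. The regression function is $f(x)=\mathbb{E}(Y\mid X=x)$. $G_X$ denotes both the marginal law of $X$ and its distribution function; it is known and continuous. $L^2(G_X)=L^2([0,1],G_X)$. **Warped wavelets.** A compactly supported, bounded wavelet basis is fixed once and for all, adapted (e.g. periodized) to $[0,1]$ in the usual way. It consists of a scaling function $\psi_{-1,0}=\phi_{0,0}$ and wavelets $\psi_{j,k}$, $j\geq 0$, $0\leq k\leq 2^j-1$, with $\|\psi_{j,k}\|_\infty\leq 2^{j/2}\|\psi\|_\infty$, and it forms an orthonormal basis of $L^2([0,1],dx)$. Constants may depend on this fixed basis. The warped system $\{\psi_{j,k}(G_X(\cdot))\}$ is then an orthonormal basis of $L^2(G_X)$. The theoretical and empirical coefficients are $$d_{j,k}=\int f(x)\,\psi_{j,k}(G_X(x))\,dG_X(x),\qquad d_{j,k}(\mathbf z)=\frac1n\sum_{i=1}^nY_i\,\psi_{j,k}(G_X(X_i)).$$ **Trees and partitions.** Nodes are pairs $(j,k)$ with $j\geq0$, $0\leq k\leq 2^j-1$, identified with the dyadic intervals $[2^{-j}k,2^{-j}(k+1)]$. The parent of $(j,k)$, $j\ge1$, is $(j-1,\lfloor k/2\rfloor)$. A tree $\mathcal T$ is a finite set of nodes containing the parent of each of its nodes other than the root $(0,0)$. The associated partition $\Lambda=\Lambda(\mathcal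 T)$ is the set of outer leaves of $\mathcal T$: the nodes not in $\mathcal T$ whose parent is in $\mathcal T$, with $\Lambda(\emptyset)=\{(0,0)\}$. To such a partition are associated $$\Pi_\Lambda(f)=d_{-1,0}\,\psi_{-1,0}(G_X)+\sum_{(j,k)\in\mathcal T\cup\Lambda}d_{j,k}\,\psi_{j,k}(G_X),$$ $$f_{\mathbf z,\Lambda}=d_{-1,0}(\mathbf z)\,\psi_{-1,0}(G_X)+\sum_{(j,k)\in\mathcal T\cup\Lambda}d_{j,k}(\mathbf z)\,\psi_{j,k}(G_X).$$ For $J\in\mathbb{N}_0$, $\Lambda_J$ is the uniform partition associated with the tree $\mathcal T_J$ of all nodes of level $j<J$, so $\Lambda_J$ consists of all nodes of level $J$. **Approximation space.** $\mathcal{A}^s$ is the set of $f\in L^2(G_X)$ for which there is $M_0\geq 0$ with $\|f-\Pi_{\Lambda_J}(f)\|_{L^2(G_X)}\leq M_0\,2^{-Js}$ for all $J\in\mathbb{N}_0$. The smallest such $M_0$ is the semi-norm $|f|_{\mathcal{A}^s}$. *)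

theory Defs
  imports "HOL-Probability.Probability"
begin

section \<open>Square-integrable functions\<close>

definition L2 :: "real measure \<Rightarrow> (real \<Rightarrow> real) set" where
  "L2 N = {g \<in> borel_measurable N. integrable N (\<lambda>x. (g x)\<^sup>2)}"

definition L2_norm :: "real measure \<Rightarrow> (real \<Rightarrow> real) \<Rightarrow> real" where
  "L2_norm N g = sqrt (\<integral>x. (g x)\<^sup>2 \<partial>N)"

definition orthonormal_basis_L2 ::
    "real measure \<Rightarrow> 'i set \<Rightarrow> ('i \<Rightarrow> real \<Rightarrow> real) \<Rightarrow> bool" where
  "orthonormal_basis_L2 N I e \<longleftrightarrow>
     (\<forall>i\<in>I. e i \<in> L2 N) \<and>
     (\<forall>i\<in>I. \<forall>i'\<in>I. (\<integral>x. e i x * e i' x \<partial>N) = (if i = i' then 1 else 0)) \<and>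
     (\<forall>g\<in>L2 N. \<forall>\<epsilon>>0. \<exists>F c. finite F \<and> F \<subseteq> I \<and>
        L2_norm N (\<lambda>x. g x - (\<Sum>i\<in>F. c i * e i x)) < \<epsilon>)"

section \<open>Wavelet bases\<close>

text \<open>Level \<open>-1\<close> carries the scaling function: \<open>\<psi>\<^sub>-\<^sub>1\<^sub>,\<^sub>k(x) = \<phi>(x - k)\<close>.\<close>

definition line_wavelet ::
    "(real \<Rightarrow> real) \<Rightarrow> (real \<Rightarrow> real) \<Rightarrow> int \<Rightarrow> int \<Rightarrow> real \<Rightarrow> real" where
  "line_wavelet \<phi> \<psi> j k x =
     (if j = - 1 then \<phi> (x - real_of_int k)
      else 2 powr (real_of_int j / 2) * \<psi> (2 powr real_of_int j * x - real_of_int k))"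

definition compact_wavelet_pair :: "(real \<Rightarrow> real) \<Rightarrow> (real \<Rightarrow> real) \<Rightarrow> bool" where
  "compact_wavelet_pair \<phi> \<psi> \<longleftrightarrow>
     \<phi> \<in> borel_measurable borel \<and> \<psi> \<in> borel_measurable borel \<and>
     bounded (range \<phi>) \<and> bounded (range \<psi>) \<and>
     bounded {x. \<phi> x \<noteq> 0} \<and> bounded {x. \<psi> x \<noteq> 0} \<and>
     orthonormal_basis_L2 lborel {(j, k). - 1 \<le> j} (\<lambda>(j, k). line_wavelet \<phi> \<psi> j k)"

definition nodes :: "(nat \<times> nat) set" where
  "nodes = {(j, k). k < 2 ^ j}"

definition wavelet_indices :: "(int \<times> nat) set" where
  "wavelet_indices = insert (- 1, 0) ((\<lambda>(j, k). (int j, k)) ` nodes)"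

text \<open>
  \<open>\<Psi> j k\<close> is the system \<open>\<psi>\<^sub>j\<^sub>,\<^sub>k\<close> on \<open>[0,1]\<close>; values of \<open>\<Psi> j k\<close> outside \<open>[0,1]\<close> are irrelevant.
  No particular adaptation of the wavelets of the line to the interval is chosen.  It is only
  required that, for some radius \<open>R\<close>, \<open>\<Psi> j k\<close> lives within \<open>R 2\<^sup>-\<^sup>j\<close> of \<open>k 2\<^sup>-\<^sup>j\<close> (distances are
  taken modulo 1, to allow for periodization), and that \<open>\<Psi> j k\<close> is the usual dilated and
  translated wavelet when \<open>k 2\<^sup>-\<^sup>j\<close> is at least \<open>R 2\<^sup>-\<^sup>j\<close> away from the boundary.
\<close>

definition unit_interval_wavelet_basis ::
    "(real \<Rightarrow> real) \<Rightarrow> (real \<Rightarrow> real) \<Rightarrow> (int \<Rightarrow> nat \<Rightarrow> real \<Rightarrow> real) \<Rightarrow> bool" where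
  "unit_interval_wavelet_basis \<phi> \<psi> \<Psi> \<longleftrightarrow>
     compact_wavelet_pair \<phi> \<psi> \<and>
     orthonormal_basis_L2 (restrict_space lborel {0..1}) wavelet_indices (\<lambda>(j, k). \<Psi> j k) \<and>
     bounded (\<Psi> (- 1) 0 ` {0..1}) \<and>
     (\<forall>(j, k)\<in>nodes. \<forall>x\<in>{0..1}.
        \<bar>\<Psi> (int j) k x\<bar> \<le> 2 powr (real j / 2) * (SUP y. \<bar>\<psi> y\<bar>)) \<and>
     (\<exists>R::nat.
        (\<forall>(j, k)\<in>nodes. \<forall>x\<in>{0..1}. \<Psi> (int j) k x \<noteq> 0 \<longrightarrow>
           (\<exists>l::int. \<bar>2 ^ j * (x + real_of_int l) - real k\<bar> \<le> real R)) \<and>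
        (\<forall>(j, k)\<in>nodes. R \<le> k \<and> k + R \<le> 2 ^ j \<longrightarrow>
           (\<forall>x\<in>{0..1}. \<Psi> (int j) k x = line_wavelet \<phi> \<psi> (int j) (int k) x)))"

section \<open>Trees and partitions\<close>

definition parent :: "nat \<times> nat \<Rightarrow> nat \<times> nat" where
  "parent \<nu> = (fst \<nu> - 1, snd \<nu> div 2)"

definition is_tree :: "(nat \<times> nat) set \<Rightarrow> bool" where
  "is_tree T \<longleftrightarrow> finite T \<and> T \<subseteq> nodes \<and> (\<forall>\<nu>\<in>T. \<nu> \<noteq> (0, 0) \<longrightarrow> parent \<nu> \<in> T)"

definition outer_leaves :: "(nat \<times> nat) set \<Rightarrow> (nat \<times> nat) set" where
  "outer_leaves T =
     (if T = {} then {(0, 0)}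
      else {\<nu> \<in> nodes. \<nu> \<notin> T \<and> 1 \<le> fst \<nu> \<and> parent \<nu> \<in> T})"

definition uniform_tree :: "nat \<Rightarrow> (nat \<times> nat) set" where
  "uniform_tree J = {\<nu> \<in> nodes. fst \<nu> < J}"

lemma finite_uniform_tree: "finite (uniform_tree J)"
proof (rule finite_subset)
  show "uniform_tree J \<subseteq> (SIGMA j:{..<J}. {..<2 ^ j})"
    by (auto simp: uniform_tree_def nodes_def)
qed simp

lemma parent_in_nodes:
  assumes "\<nu> \<in> nodes" "1 \<le> fst \<nu>"
  shows "parent \<nu> \<in> nodes"
proof -
  obtain j k where \<nu>: "\<nu> = (Suc j, k)"
    using assms(2) by (cases \<nu>) (auto simp: Suc_le_eq gr0_conv_Suc)
  with assms(1) show ?thesis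
    by (auto simp: nodes_def parent_def)
qed

lemma is_tree_uniform_tree: "is_tree (uniform_tree J)"
  unfolding is_tree_def
proof (intro conjI ballI impI)
  fix \<nu> assume \<nu>: "\<nu> \<in> uniform_tree J" "\<nu> \<noteq> (0, 0)"
  then have "1 \<le> fst \<nu>"
    by (cases \<nu>) (auto simp: uniform_tree_def nodes_def Suc_le_eq intro!: gr0I)
  with \<nu> parent_in_nodes[of \<nu>] show "parent \<nu> \<in> uniform_tree J"
    by (auto simp: uniform_tree_def parent_def)
qed (use finite_uniform_tree in \<open>auto simp: uniform_tree_def\<close>)

lemma outer_leaves_uniform_tree: "outer_leaves (uniform_tree J) = {\<nu> \<in> nodes. fst \<nu> = J}"
proof (cases J)
  case 0
  then show ?thesis by (auto simp: outer_leaves_def uniform_tree_def nodes_def)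
next
  case (Suc J')
  then have "(0, 0) \<in> uniform_tree J"
    by (auto simp: uniform_tree_def nodes_def)
  then have "uniform_tree J \<noteq> {}" by blast
  then show ?thesis
    using Suc by (auto simp: outer_leaves_def uniform_tree_def parent_def nodes_def)
qed

section \<open>The regression model\<close>

definition law_X :: "(real \<times> real) measure \<Rightarrow> real measure" where
  "law_X P = distr P borel fst"

definition G_X :: "(real \<times> real) measure \<Rightarrow> real \<Rightarrow> real" where
  "G_X P = cdf (law_X P)"

text \<open>\<open>f\<close> is any Borel version of \<open>x \<mapsto> E(Y | X = x)\<close>, i.e. \<open>f(X)\<close> is a version of \<open>E(Y | \<sigma>(X))\<close>.\<close>

definition regression_function :: "(real \<times> real) measure \<Rightarrow> (real \<Rightarrow> real) \<Rightarrow> bool" where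
  "regression_function P f \<longleftrightarrow>
     f \<in> borel_measurable borel \<and>
     (AE z in P. real_cond_exp P (vimage_algebra (space P) fst borel) snd z = f (fst z))"

definition regression_model ::
    "real \<Rightarrow> (real \<times> real) measure \<Rightarrow> (real \<Rightarrow> real) \<Rightarrow> bool" where
  "regression_model M P f \<longleftrightarrow>
     prob_space P \<and> sets P = sets borel \<and>
     (AE z in P. z \<in> {0..1} \<times> {- M..M}) \<and>
     continuous_on UNIV (G_X P) \<and>
     regression_function P f"

definition sample_law :: "(real \<times> real) measure \<Rightarrow> nat \<Rightarrow> (nat \<Rightarrow> real \<times> real) measure" where
  "sample_law P n = PiM {..<n} (\<lambda>_. P)"

section \<open>Warped coefficients, projections and estimators\<close>

text \<open>Partitions are represented by their trees, which they determine.\<close>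

context
  fixes \<Psi> :: "int \<Rightarrow> nat \<Rightarrow> real \<Rightarrow> real" and P :: "(real \<times> real) measure"
begin

definition coeff :: "(real \<Rightarrow> real) \<Rightarrow> int \<Rightarrow> nat \<Rightarrow> real" where
  "coeff f j k = (\<integral>x. f x * \<Psi> j k (G_X P x) \<partial>law_X P)"

definition emp_coeff :: "nat \<Rightarrow> (nat \<Rightarrow> real \<times> real) \<Rightarrow> int \<Rightarrow> nat \<Rightarrow> real" where
  "emp_coeff n z j k = (\<Sum>i<n. snd (z i) * \<Psi> j k (G_X P (fst (z i)))) / real n"

definition projection :: "(nat \<times> nat) set \<Rightarrow> (real \<Rightarrow> real) \<Rightarrow> real \<Rightarrow> real" where
  "projection T f x =
     coeff f (- 1) 0 * \<Psi> (- 1) 0 (G_X P x) +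
     (\<Sum>(j, k)\<in>T \<union> outer_leaves T. coeff f (int j) k * \<Psi> (int j) k (G_X P x))"

definition estimator ::
    "nat \<Rightarrow> (nat \<times> nat) set \<Rightarrow> (nat \<Rightarrow> real \<times> real) \<Rightarrow> real \<Rightarrow> real" where
  "estimator n T z x =
     emp_coeff n z (- 1) 0 * \<Psi> (- 1) 0 (G_X P x) +
     (\<Sum>(j, k)\<in>T \<union> outer_leaves T. emp_coeff n z (int j) k * \<Psi> (int j) k (G_X P x))"

definition approx_bound :: "real \<Rightarrow> (real \<Rightarrow> real) \<Rightarrow> real \<Rightarrow> bool" where
  "approx_bound s f M0 \<longleftrightarrow> 0 \<le> M0 \<and>
     (\<forall>J. L2_norm (law_X P) (\<lambda>x. f x - projection (uniform_tree J) f x)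
            \<le> M0 * 2 powr (- real J * s))"

definition approx_space :: "real \<Rightarrow> (real \<Rightarrow> real) set" where
  "approx_space s = {f \<in> L2 (law_X P). \<exists>M0. approx_bound s f M0}"

definition approx_seminorm :: "real \<Rightarrow> (real \<Rightarrow> real) \<Rightarrow> real" where
  "approx_seminorm s f = (LEAST M0. approx_bound s f M0)"

end

definition J_star :: "real \<Rightarrow> nat \<Rightarrow> nat" where
  "J_star s n = (LEAST j::nat. 2 powr (real j * (1 + 2 * s)) \<ge> real n / ln (real n))"

definition estimation_error ::
    "(int \<Rightarrow> nat \<Rightarrow> real \<Rightarrow> real) \<Rightarrow> (real \<times> real) measure \<Rightarrow> (real \<Rightarrow> real) \<Rightarrow> real \<Rightarrow> nat \<Rightarrow>
     (nat \<Rightarrow> real \<times> real) \<Rightarrow> real" where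
  "estimation_error \<Psi> P f s n z =
     L2_norm (law_X P) (\<lambda>x. f x - estimator \<Psi> P n (uniform_tree (J_star s n)) z x)"

end

theory Submission
  imports Defs
begin

text \<open>
  The distribution function \<open>G\<close> of \<open>X\<close> is continuous, so \<open>G(X)\<close> is uniform on \<open>[0,1]\<close>
  (\<open>distr_cdf_uniform\<close>).  The warped system \<open>\<psi>\<^sub>j\<^sub>,\<^sub>k(G)\<close> is therefore orthonormal in
  \<open>L\<^sup>2(G)\<close>, and the squared error of the estimator splits
  (\<open>estimation_error_pythagoras\<close>) into the squared bias and the sum of the squared errors of
  the empirical coefficients of level at most \<open>J\<close>, where \<open>J = J\<^sup>\<star>\<close>.  Write \<open>\<rho>\<close> for the rate
  \<open>(log n / n)\<^sup>s\<^sup>/\<^sup>(\<^sup>2\<^sup>s\<^sup>+\<^sup>1\<^sup>)\<close>.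

  The choice of \<open>J\<close> gives \<open>2\<^sup>-\<^sup>J\<^sup>s \<le> \<rho>\<close>, so that the bias is at most \<open>\<rho>\<close> times the
  semi-norm of \<open>f\<close>.  There are \<open>2\<^sup>J\<^sup>+\<^sup>1\<close> coefficients, and minimality of \<open>J\<close> gives
  \<open>2\<^sup>J\<^sup>+\<^sup>1 (log n / n) \<le> (2 \<rho>)\<^sup>2\<close> (\<open>J_star_bounds\<close>).

  An empirical coefficient is the mean of \<open>n\<close> independent copies of \<open>Y \<psi>\<^sub>j\<^sub>,\<^sub>k(G(X))\<close>.  This
  variable has expectation \<open>d\<^sub>j\<^sub>,\<^sub>k\<close> by the definition of the regression function, second
  moment at most \<open>M\<^sup>2\<close> by orthonormality, and is bounded by a multiple of \<open>2\<^sup>J\<^sup>/\<^sup>2\<close>.  The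
  variance bound \<open>M\<^sup>2 / n\<close>, summed over the coefficients, gives the bound in expectation.  For
  the bound in probability, a Chernoff bound of Bernstein type (\<open>sample_mean_tail\<close>) shows that
  a coefficient errs by more than \<open>c \<surd>(log n / n)\<close> with probability at most
  \<open>2 n\<^sup>-\<^sup>(\<^sup>\<beta>\<^sup>+\<^sup>1\<^sup>)\<close>; the number of coefficients being \<open>O(n)\<close>, a union bound leaves \<open>C n\<^sup>-\<^sup>\<beta>\<close>.
  The Chernoff parameter is \<open>t \<surd>(log n / n)\<close> with \<open>t\<close> independent of \<open>\<beta>\<close>: since \<open>2\<^sup>J\<close> is at most
  \<open>2 n / log n\<close> whatever \<open>s\<close> is, a fixed small \<open>t\<close> is admissible at all these levels, and only \<open>c\<close> has
  to grow with \<open>\<beta>\<close>.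
\<close>

section \<open>The probability integral transform\<close>

text \<open>
  For a general distribution function the quantile function \<open>I\<close> only satisfies \<open>u \<le> C (I u)\<close>;
  continuity makes it a right inverse.
\<close>

lemma (in cdf_distribution) cdf_pseudoinverse:
  assumes "continuous_on UNIV C" "0 < u" "u < 1"
  shows "C (I u) = u"
proof -
  obtain a where a: "C a < u"
    by (metis eventually_happens' trivial_limit_at_bot_linorder order_tendstoD(2) bot \<open>0 < u\<close>)
  obtain b where b: "u < C b"
    using order_tendstoD(1)[OF top \<open>u < 1\<close>]
    by (auto dest!: eventually_happens'[OF trivial_limit_at_top_linorder])
  have "a \<le> b"
    using a b cdf_nondecreasing[of b a] by linarith
  with a b obtain y where y: "C y = u"
    using IVT'[of C a u b] continuous_on_subset[OF assms(1)] by auto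
  have "I u \<le> y"
    using pseudoinverse[of u y] assms y by simp
  then have "C (I u) \<le> u"
    using cdf_nondecreasing y by metis
  moreover have "u \<le> C (I u)"
    using pseudoinverse[of u "I u"] assms by simp
  ultimately show ?thesis by simp
qed

lemma (in cdf_distribution) measurable_cdf_unit [measurable]:
  "C \<in> measurable M (restrict_space lborel {0..1})"
  by (rule measurable_restrict_space2) (auto simp: cdf_nonneg cdf_bounded_prob)

lemma (in cdf_distribution) distr_cdf_uniform:
  assumes "continuous_on UNIV C"
  shows "distr M (restrict_space lborel {0..1}) C = restrict_space lborel {0..1}"
proof (rule measure_eqI)
  fix A assume "A \<in> sets (distr M (restrict_space lborel {0..1}) C)"
  then have A: "A \<in> sets (restrict_space lborel {0..1::real})" by simp
  then have Ab: "A \<in> sets borel" "A \<subseteq> {0..1}"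
    by (auto simp: sets_restrict_space_iff)
  have CA: "C -` A \<in> sets borel"
    using measurable_sets[OF measurable_C Ab(1)] by simp
  have "emeasure (distr M (restrict_space lborel {0..1}) C) A = emeasure M (C -` A)"
    using A by (subst emeasure_distr) auto
  \<comment> \<open>The measure is the law of the quantile function of a uniform variable, which \<open>C\<close> undoes.\<close>
  also have "\<dots> = emeasure (distr (restrict_space lborel {0<..<1::real}) borel I) (C -` A)"
    by (simp only: distr_I_eq_M)
  also have "\<dots> = emeasure (restrict_space lborel {0<..<1::real}) (I -` (C -` A) \<inter> {0<..<1})"
    using CA by (subst emeasure_distr) (auto simp: space_restrict_space)
  also have "I -` (C -` A) \<inter> {0<..<1} = A \<inter> {0<..<1}"
    using cdf_pseudoinverse[OF assms] by auto
  also have "emeasure (restrict_space lborel {0<..<1::real}) (A \<inter> {0<..<1})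
      = emeasure lborel (A \<inter> {0<..<1})"
    by (subst emeasure_restrict_space) auto
  also have "\<dots> = emeasure lborel A"
  proof (rule emeasure_eq_AE)
    show "AE x in lborel. x \<in> A \<inter> {0<..<1} \<longleftrightarrow> x \<in> A"
      using AE_lborel_singleton[of 0] AE_lborel_singleton[of 1]
      by eventually_elim (use Ab(2) in auto)
  qed (use Ab in auto)
  also have "\<dots> = emeasure (restrict_space lborel {0..1::real}) A"
    using Ab by (subst emeasure_restrict_space) auto
  finally show "emeasure (distr M (restrict_space lborel {0..1}) C) A
    = emeasure (restrict_space lborel {0..1}) A" .
qed simp

section \<open>Least squares in an orthonormal system\<close>

lemma integrable_mult_square:
  fixes u v :: "'a \<Rightarrow> real"
  assumes [measurable]: "u \<in> borel_measurable N" "v \<in> borel_measurable N"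
    and u: "integrable N (\<lambda>x. (u x)\<^sup>2)" and v: "integrable N (\<lambda>x. (v x)\<^sup>2)"
  shows "integrable N (\<lambda>x. u x * v x)"
proof (rule Bochner_Integration.integrable_bound)
  show "integrable N (\<lambda>x. (u x)\<^sup>2 + (v x)\<^sup>2)"
    using u v by simp
  show "AE x in N. norm (u x * v x) \<le> norm ((u x)\<^sup>2 + (v x)\<^sup>2)"
  proof (rule AE_I2)
    fix x
    have "0 \<le> (\<bar>u x\<bar> - \<bar>v x\<bar>)\<^sup>2" by simp
    then have "2 * (\<bar>u x\<bar> * \<bar>v x\<bar>) \<le> (u x)\<^sup>2 + (v x)\<^sup>2"
      by (simp add: power2_diff)
    moreover have "0 \<le> \<bar>u x\<bar> * \<bar>v x\<bar>" by simp
    ultimately have "\<bar>u x\<bar> * \<bar>v x\<bar> \<le> (u x)\<^sup>2 + (v x)\<^sup>2" by linarith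
    then show "norm (u x * v x) \<le> norm ((u x)\<^sup>2 + (v x)\<^sup>2)"
      by (simp add: abs_mult)
  qed
qed simp

lemma integral_square_diff_orthonormal:
  fixes g :: "real \<Rightarrow> real" and e :: "'i \<Rightarrow> real \<Rightarrow> real"
  assumes fin: "finite I" and g: "g \<in> L2 N" and e: "\<And>i. i \<in> I \<Longrightarrow> e i \<in> L2 N"
    and ortho: "\<And>i k. i \<in> I \<Longrightarrow> k \<in> I \<Longrightarrow> (\<integral>x. e i x * e k x \<partial>N) = (if i = k then 1 else 0)"
  shows "(\<integral>x. (g x - (\<Sum>i\<in>I. a i * e i x))\<^sup>2 \<partial>N)
    = (\<integral>x. (g x)\<^sup>2 \<partial>N) - 2 * (\<Sum>i\<in>I. a i * (\<integral>x. g x * e i x \<partial>N)) + (\<Sum>i\<in>I. (a i)\<^sup>2)"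
proof -
  have ge: "integrable N (\<lambda>x. g x * e i x)" if "i \<in> I" for i
    using g e[OF that] by (intro integrable_mult_square) (auto simp: L2_def)
  have ee: "integrable N (\<lambda>x. e i x * e k x)" if "i \<in> I" "k \<in> I" for i k
    using e that by (intro integrable_mult_square) (auto simp: L2_def)
  have gg: "integrable N (\<lambda>x. (g x)\<^sup>2)"
    using g by (simp add: L2_def)
  have expand: "(g x - (\<Sum>i\<in>I. a i * e i x))\<^sup>2 = (g x)\<^sup>2 - 2 * (\<Sum>i\<in>I. a i * (g x * e i x))
      + (\<Sum>i\<in>I. \<Sum>k\<in>I. a i * a k * (e i x * e k x))" for x
  proof -
    have "(\<Sum>i\<in>I. a i * e i x)\<^sup>2 = (\<Sum>i\<in>I. \<Sum>k\<in>I. a i * a k * (e i x * e k x))"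
      by (simp add: power2_eq_square sum_product mult_ac)
    moreover have "g x * (\<Sum>i\<in>I. a i * e i x) = (\<Sum>i\<in>I. a i * (g x * e i x))"
      by (simp add: sum_distrib_left mult_ac)
    ultimately show ?thesis by (simp add: power2_diff)
  qed
  have "(\<integral>x. (g x - (\<Sum>i\<in>I. a i * e i x))\<^sup>2 \<partial>N)
    = (\<integral>x. (g x)\<^sup>2 - 2 * (\<Sum>i\<in>I. a i * (g x * e i x))
          + (\<Sum>i\<in>I. \<Sum>k\<in>I. a i * a k * (e i x * e k x)) \<partial>N)"
    by (simp only: expand)
  also have "\<dots> = (\<integral>x. (g x)\<^sup>2 \<partial>N) - 2 * (\<Sum>i\<in>I. a i * (\<integral>x. g x * e i x \<partial>N))
      + (\<Sum>i\<in>I. \<Sum>k\<in>I. a i * a k * (\<integral>x. e i x * e k x \<partial>N))"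
    using gg ge ee by simp
  also have "(\<Sum>i\<in>I. \<Sum>k\<in>I. a i * a k * (\<integral>x. e i x * e k x \<partial>N))
      = (\<Sum>i\<in>I. \<Sum>k\<in>I. if i = k then a i * a k else 0)"
    by (intro sum.cong refl) (simp add: ortho)
  also have "\<dots> = (\<Sum>i\<in>I. (a i)\<^sup>2)"
    using fin by (simp add: power2_eq_square)
  finally show ?thesis .
qed

section \<open>Means of independent samples\<close>

lemma exp_le_quadratic:
  fixes x :: real
  assumes "\<bar>x\<bar> \<le> 1"
  shows "exp x \<le> 1 + x + x\<^sup>2"
proof (cases "0 \<le> x")
  case True
  then show ?thesis using assms by (intro exp_bound) auto
next
  case False
  \<comment> \<open>For negative \<open>x\<close>, compare with \<open>exp x = 1 / exp (- x)\<close> and \<open>1 - x \<le> exp (- x)\<close>.\<close>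
  have "exp x * (1 - x) \<le> exp x * exp (- x)"
    using exp_ge_add_one_self[of "- x"] by (intro mult_left_mono) auto
  also have "\<dots> = 1" by (simp flip: exp_add)
  also have "\<dots> \<le> (1 + x + x\<^sup>2) * (1 - x)"
  proof -
    have "x ^ 3 \<le> 0" using False by (simp add: power_le_zero_eq)
    then show ?thesis by (simp add: algebra_simps power2_eq_square power3_eq_cube)
  qed
  finally show ?thesis using False by (simp add: mult_le_cancel_right)
qed

context
  fixes P :: "(real \<times> real) measure" and n :: nat
  assumes P: "prob_space P"
begin

interpretation P: prob_space P by (rule P)
interpretation S: product_prob_space "\<lambda>_::nat. P" "{..<n}" ..

lemma prob_space_sample_law: "prob_space (sample_law P n)"
  unfolding sample_law_def by (intro prob_space_PiM P)

lemma measurable_sample_component: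
  "i < n \<Longrightarrow> (\<lambda>z. z i) \<in> measurable (sample_law P n) P"
  unfolding sample_law_def by measurable

lemma distr_sample_component: "i < n \<Longrightarrow> distr (sample_law P n) P (\<lambda>z. z i) = P"
  unfolding sample_law_def by (intro distr_PiM_component) (auto intro: P)

lemma sample_sum_second_moment:
  fixes h :: "real \<times> real \<Rightarrow> real"
  assumes h: "h \<in> borel_measurable P" and h2: "integrable P (\<lambda>x. (h x)\<^sup>2)"
    and h0: "(\<integral>x. h x \<partial>P) = 0"
  shows "integrable (sample_law P n) (\<lambda>z. (\<Sum>i<n. h (z i))\<^sup>2)"
    and "(\<integral>z. (\<Sum>i<n. h (z i))\<^sup>2 \<partial>sample_law P n) = n * (\<integral>x. (h x)\<^sup>2 \<partial>P)"
proof -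
  have hi: "integrable P h"
    using h h2 by (rule P.square_integrable_imp_integrable)
  have cross: "integrable (sample_law P n) (\<lambda>z. h (z i) * h (z k)) \<and>
      (\<integral>z. h (z i) * h (z k) \<partial>sample_law P n) = (if i = k then \<integral>x. (h x)\<^sup>2 \<partial>P else 0)"
    if i: "i < n" and k: "k < n" for i k
  proof (cases "i = k")
    case True
    note measurable_sample_component [measurable]
    have "integrable (distr (sample_law P n) P (\<lambda>z. z i)) (\<lambda>x. (h x)\<^sup>2)"
      using h2 by (simp add: distr_sample_component[OF i])
    then have "integrable (sample_law P n) (\<lambda>z. (h (z i))\<^sup>2)"
      using h i by (subst (asm) integrable_distr_eq) auto
    moreover have "(\<integral>z. (h (z i))\<^sup>2 \<partial>sample_law P n) = (\<integral>x. (h x)\<^sup>2 \<partial>P)"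
      using h i integral_distr[of "\<lambda>z. z i" "sample_law P n" P "\<lambda>x. (h x)\<^sup>2"]
      by (simp add: distr_sample_component)
    ultimately show ?thesis using True by (simp add: power2_eq_square)
  next
    case False
    \<comment> \<open>The cross term, as a product of functions of one coordinate each.\<close>
    define F :: "nat \<Rightarrow> real \<times> real \<Rightarrow> real"
      where "F l x = (if l = i then h x else 1) * (if l = k then h x else 1)" for l x
    have Fint: "integrable P (F l)" for l
      using hi False by (cases "l = i"; cases "l = k") (simp_all add: F_def[abs_def])
    have F: "(\<Prod>l<n. F l (z l)) = h (z i) * h (z k)" for z
      unfolding F_def prod.distrib using i k by (simp add: prod.delta)
    have "(\<integral>x. F i x \<partial>P) = 0"
      using h0 False by (simp add: F_def)
    then have "(\<Prod>l<n. \<integral>x. F l x \<partial>P) = 0"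
      using i by (intro prod_zero) auto
    then show ?thesis
      using False S.product_integrable_prod[of "{..<n}" F] S.product_integral_prod[of "{..<n}" F] Fint
      by (simp add: F sample_law_def)
  qed
  have expand: "(\<Sum>i<n. h (z i))\<^sup>2 = (\<Sum>i<n. \<Sum>k<n. h (z i) * h (z k))" for z :: "nat \<Rightarrow> real \<times> real"
    by (simp add: power2_eq_square sum_product)
  show "integrable (sample_law P n) (\<lambda>z. (\<Sum>i<n. h (z i))\<^sup>2)"
    unfolding expand using cross by (intro Bochner_Integration.integrable_sum) auto
  have "(\<integral>z. (\<Sum>i<n. h (z i))\<^sup>2 \<partial>sample_law P n)
      = (\<Sum>i<n. \<Sum>k<n. \<integral>z. h (z i) * h (z k) \<partial>sample_law P n)"
    unfolding expand using cross
    by (subst Bochner_Integration.integral_sum, (auto intro!: Bochner_Integration.integrable_sum)[1])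
      (intro sum.cong refl Bochner_Integration.integral_sum, auto)
  also have "\<dots> = (\<Sum>i<n. \<Sum>k<n. if i = k then \<integral>x. (h x)\<^sup>2 \<partial>P else 0)"
    using cross by (intro sum.cong refl) auto
  also have "\<dots> = n * (\<integral>x. (h x)\<^sup>2 \<partial>P)"
    by simp
  finally show "(\<integral>z. (\<Sum>i<n. h (z i))\<^sup>2 \<partial>sample_law P n) = n * (\<integral>x. (h x)\<^sup>2 \<partial>P)" .
qed

lemma sample_mean_variance:
  fixes h :: "real \<times> real \<Rightarrow> real"
  assumes h[measurable]: "h \<in> borel_measurable P" and h2: "integrable P (\<lambda>x. (h x)\<^sup>2)" and n: "0 < n"
  defines "D \<equiv> \<lambda>z. (\<Sum>i<n. h (z i)) / n - (\<integral>x. h x \<partial>P)"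
  shows "integrable (sample_law P n) (\<lambda>z. (D z)\<^sup>2)"
    and "(\<integral>z. (D z)\<^sup>2 \<partial>sample_law P n) \<le> (\<integral>x. (h x)\<^sup>2 \<partial>P) / n"
proof -
  define m where "m = (\<integral>x. h x \<partial>P)"
  define h' where "h' x = h x - m" for x
  have hi: "integrable P h"
    using h h2 by (rule P.square_integrable_imp_integrable)
  have h'2: "integrable P (\<lambda>x. (h' x)\<^sup>2)"
    unfolding h'_def power2_diff using hi h2 by simp
  have h'0: "(\<integral>x. h' x \<partial>P) = 0"
    using hi by (simp add: h'_def m_def P.prob_space)
  have D: "(D z)\<^sup>2 = (\<Sum>i<n. h' (z i))\<^sup>2 / n\<^sup>2" for z
    using n by (simp add: D_def h'_def m_def sum_subtractf field_simps)
  have h'm: "h' \<in> borel_measurable P" unfolding h'_def by measurable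
  note mom = sample_sum_second_moment[OF h'm h'2 h'0]
  show "integrable (sample_law P n) (\<lambda>z. (D z)\<^sup>2)"
    unfolding D using mom(1) by simp
  have "(\<integral>z. (D z)\<^sup>2 \<partial>sample_law P n) = (\<integral>x. (h' x)\<^sup>2 \<partial>P) / n"
    unfolding D using mom(2) n by (simp add: power2_eq_square)
  also have "(\<integral>x. (h' x)\<^sup>2 \<partial>P) \<le> (\<integral>x. (h x)\<^sup>2 \<partial>P)"
    using P.variance_eq[OF hi h2] by (simp add: h'_def m_def)
  finally show "(\<integral>z. (D z)\<^sup>2 \<partial>sample_law P n) \<le> (\<integral>x. (h x)\<^sup>2 \<partial>P) / n"
    using n by (simp add: divide_right_mono)
qed

text \<open>
  A Chernoff bound with a free parameter \<open>r\<close>.  Unlike Hoeffding's inequality it sees the bound \<open>B\<close>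
  only through the constraint \<open>r B \<le> 1\<close>, while the exponent depends on the second moment.  That
  is what is needed for wavelets of high level, which are large but have norm one.
\<close>

lemma sample_mean_upper_tail:
  fixes h :: "real \<times> real \<Rightarrow> real" and r B V \<eta> :: real
  assumes h[measurable]: "h \<in> borel_measurable P" and B: "AE x in P. \<bar>h x\<bar> \<le> B"
    and V: "(\<integral>x. (h x)\<^sup>2 \<partial>P) \<le> V" and r: "0 < r" "r * B \<le> 1" and n: "0 < n"
  shows "measure (sample_law P n)
      {z \<in> space (sample_law P n). (\<Sum>i<n. h (z i)) / n - (\<integral>x. h x \<partial>P) \<ge> \<eta>}
    \<le> exp (n * (r\<^sup>2 * V - r * \<eta>))"
proof -
  define m where "m = (\<integral>x. h x \<partial>P)"
  have hi: "integrable P h"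
    using B by (intro P.integrable_const_bound[of _ B]) auto
  have h2: "integrable P (\<lambda>x. (h x)\<^sup>2)"
    using B by (intro P.integrable_const_bound[of _ "B\<^sup>2"])
      (auto simp: abs_le_square_iff[symmetric] elim!: eventually_mono)
  have small: "AE x in P. \<bar>r * h x\<bar> \<le> 1"
    using B
  proof eventually_elim
    case (elim x)
    then have "r * \<bar>h x\<bar> \<le> r * B" using r by (intro mult_left_mono) auto
    with r(2) have "r * \<bar>h x\<bar> \<le> 1" by linarith
    then show ?case using r by (simp add: abs_mult)
  qed
  have expi: "integrable P (\<lambda>x. exp (r * h x))"
    using small by (intro P.integrable_const_bound[of _ "exp 1"]) (auto elim!: eventually_mono)
  have "AE x in P. exp (r * h x) \<le> 1 + r * h x + (r * h x)\<^sup>2"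
    using small by eventually_elim (rule exp_le_quadratic)
  then have "(\<integral>x. exp (r * h x) \<partial>P) \<le> (\<integral>x. 1 + r * h x + (r * h x)\<^sup>2 \<partial>P)"
    using hi h2 expi by (intro integral_mono_AE) (auto simp: power_mult_distrib)
  also have "\<dots> = 1 + r * m + r\<^sup>2 * (\<integral>x. (h x)\<^sup>2 \<partial>P)"
    using hi h2 by (simp add: power_mult_distrib m_def P.prob_space)
  also have "\<dots> \<le> 1 + (r * m + r\<^sup>2 * V)"
    using V by (simp add: mult_left_mono)
  also have "\<dots> \<le> exp (r * m + r\<^sup>2 * V)"
    by (rule exp_ge_add_one_self)
  finally have mgf: "(\<integral>x. exp (r * h x) \<partial>P) \<le> exp (r * m + r\<^sup>2 * V)" .
  define E where "E z = (\<Prod>i<n. exp (r * h (z i)))" for z :: "nat \<Rightarrow> real \<times> real"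
  have E_nonneg: "0 \<le> E z" for z
    by (simp add: E_def prod_nonneg)
  have Ei: "integrable (sample_law P n) E"
    unfolding E_def sample_law_def using expi by (intro S.product_integrable_prod) auto
  have "(\<integral>z. E z \<partial>sample_law P n) = (\<integral>x. exp (r * h x) \<partial>P) ^ n"
    unfolding E_def sample_law_def using expi by (subst S.product_integral_prod) auto
  also have "\<dots> \<le> exp (r * m + r\<^sup>2 * V) ^ n"
    using mgf by (intro power_mono) auto
  also have "\<dots> = exp (n * (r * m + r\<^sup>2 * V))"
    by (simp add: exp_of_nat_mult)
  finally have EE: "(\<integral>z. E z \<partial>sample_law P n) \<le> exp (n * (r * m + r\<^sup>2 * V))" .
  have "{z \<in> space (sample_law P n). (\<Sum>i<n. h (z i)) / n - m \<ge> \<eta>}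
      = {z \<in> space (sample_law P n). E z \<ge> exp (n * r * (m + \<eta>))}"
  proof -
    have "(\<Sum>i<n. h (z i)) / n - m \<ge> \<eta> \<longleftrightarrow> E z \<ge> exp (n * r * (m + \<eta>))" for z
    proof -
      have "(\<Sum>i<n. h (z i)) / n - m \<ge> \<eta> \<longleftrightarrow> n * (m + \<eta>) \<le> (\<Sum>i<n. h (z i))"
        using n by (simp add: field_simps)
      also have "\<dots> \<longleftrightarrow> r * (n * (m + \<eta>)) \<le> r * (\<Sum>i<n. h (z i))"
        using r by simp
      also have "\<dots> \<longleftrightarrow> E z \<ge> exp (n * r * (m + \<eta>))"
        by (simp add: E_def exp_sum[symmetric] sum_distrib_left mult_ac)
      finally show ?thesis .
    qed
    then show ?thesis by simp
  qed
  also have "measure (sample_law P n) \<dots> \<le> (\<integral>z. E z \<partial>sample_law P n) / exp (n * r * (m + \<eta>))"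
    using Ei by (intro integral_Markov_inequality_measure[where A="space (sample_law P n)"])
      (auto simp: E_nonneg)
  also have "\<dots> \<le> exp (n * (r * m + r\<^sup>2 * V)) / exp (n * r * (m + \<eta>))"
    using EE by (simp add: divide_right_mono)
  also have "\<dots> = exp (n * (r\<^sup>2 * V - r * \<eta>))"
    by (simp add: exp_diff[symmetric] algebra_simps)
  finally show ?thesis by (simp add: m_def)
qed

lemma sample_mean_tail:
  fixes h :: "real \<times> real \<Rightarrow> real" and r B V \<eta> :: real
  assumes h[measurable]: "h \<in> borel_measurable P" and B: "AE x in P. \<bar>h x\<bar> \<le> B"
    and V: "(\<integral>x. (h x)\<^sup>2 \<partial>P) \<le> V" and r: "0 < r" "r * B \<le> 1" and n: "0 < n"
  shows "measure (sample_law P n)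
      {z \<in> space (sample_law P n). \<bar>(\<Sum>i<n. h (z i)) / n - (\<integral>x. h x \<partial>P)\<bar> \<ge> \<eta>}
    \<le> 2 * exp (n * (r\<^sup>2 * V - r * \<eta>))"
proof -
  interpret L: prob_space "sample_law P n" by (rule prob_space_sample_law)
  note measurable_sample_component [measurable]
  define D where "D h z = (\<Sum>i<n. h (z i)) / n - (\<integral>x. h x \<partial>P)"
    for h and z :: "nat \<Rightarrow> real \<times> real"
  let ?A = "\<lambda>h. {z \<in> space (sample_law P n). D h z \<ge> \<eta>}"
  have meas: "?A h \<in> sets (sample_law P n)" if [measurable]: "h \<in> borel_measurable P" for h
    unfolding D_def by measurable
  have neg: "D (\<lambda>x. - h x) z = - D h z" for z
    by (simp add: D_def sum_negf)
  have "{z \<in> space (sample_law P n). \<bar>D h z\<bar> \<ge> \<eta>} = ?A h \<union> ?A (\<lambda>x. - h x)"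
    unfolding neg by auto
  also have "L.prob \<dots> \<le> L.prob (?A h) + L.prob (?A (\<lambda>x. - h x))"
    by (intro measure_Un_le meas) auto
  also have "\<dots> \<le> exp (n * (r\<^sup>2 * V - r * \<eta>)) + exp (n * (r\<^sup>2 * V - r * \<eta>))"
    unfolding D_def using assms by (intro add_mono sample_mean_upper_tail[where B=B]) auto
  finally show ?thesis by (simp add: D_def)
qed

end

section \<open>The choice of the resolution level\<close>

lemma J_star_bounds:
  fixes s :: real and n :: nat
  assumes s: "0 < s" and n: "2 \<le> n"
  defines "\<rho> \<equiv> (ln n / n) powr (s / (2 * s + 1))"
  shows "2 powr (- real (J_star s n) * s) \<le> \<rho>"
    and "2 ^ J_star s n \<le> 2 * (n / ln n)"
    and "2 ^ (J_star s n + 1) * (ln n / n) \<le> (2 * \<rho>)\<^sup>2"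
proof -
  define q where "q = real n / ln n"
  define J where "J = J_star s n"
  define p where "p = 1 + 2 * s"
  have p: "1 < p" using s by (simp add: p_def)
  have ln_pos: "0 < ln (real n)" using n by simp
  have "ln (real n) < n" using n ln_less_self[of n] by simp
  then have q: "1 < q" using ln_pos by (simp add: q_def)
  have J_def': "J = (LEAST j::nat. 2 powr (real j * p) \<ge> q)"
    by (simp add: J_def J_star_def q_def p_def)
  obtain j :: nat where j: "q < 2 ^ j"
    using real_arch_pow[of 2 q] by auto
  have "real j \<le> real j * p" using p by (simp add: mult_le_cancel_left1)
  then have "(2::real) powr real j \<le> 2 powr (real j * p)" by simp
  with j have "q \<le> 2 powr (real j * p)" by (simp add: powr_realpow)
  then have J: "q \<le> 2 powr (real J * p)"
    unfolding J_def' by (rule LeastI)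
  \<comment> \<open>As \<open>q > 1\<close>, level \<open>0\<close> is not admissible, so minimality can be used at level \<open>J - 1\<close>.\<close>
  have "J \<noteq> 0"
  proof
    assume "J = 0"
    with J q show False by simp
  qed
  then have "\<not> q \<le> 2 powr (real (J - 1) * p)"
    unfolding J_def' by (intro not_less_Least) simp
  then have "2 powr (real (J - 1) * p) \<le> q" by simp
  then have "(2 powr (real (J - 1) * p)) powr (1 / p) \<le> q powr (1 / p)"
    using p by (intro powr_mono2) auto
  then have "2 powr real (J - 1) \<le> q powr (1 / p)"
    using p by (simp add: powr_powr)
  moreover have "2 powr real J = 2 * 2 powr real (J - 1)"
    using \<open>J \<noteq> 0\<close> by (cases J) (simp_all add: powr_add)
  ultimately have up: "2 ^ J \<le> 2 * q powr (1 / p)"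
    by (simp add: powr_realpow)
  have "q powr (1 / p) \<le> q powr 1"
    using p q by (intro powr_mono) auto
  with up q show "2 ^ J_star s n \<le> 2 * (n / ln n)"
    by (simp add: J_def q_def)
  have inv: "ln n / n = 1 / q" by (simp add: q_def)
  have \<rho>: "\<rho> = q powr (- (s / p))"
    unfolding \<rho>_def inv using q by (simp add: p_def powr_divide powr_minus_divide add.commute)
  have "(2 powr (real J * p)) powr (- (s / p)) \<le> q powr (- (s / p))"
    using J q p s by (intro powr_mono2') auto
  then show "2 powr (- real (J_star s n) * s) \<le> \<rho>"
    using p by (simp add: \<rho> powr_powr J_def)
  have "2 ^ (J + 1) * (ln n / n) \<le> 4 * q powr (1 / p) * (1 / q)"
    unfolding inv using up q by (intro mult_right_mono) auto
  also have "1 / q = q powr (- 1)"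
    using q by (simp add: powr_minus divide_inverse)
  also have "4 * q powr (1 / p) * q powr (- 1) = 4 * q powr (1 / p - 1)"
    by (simp add: powr_diff powr_minus divide_inverse)
  also have "1 / p - 1 = - (s / p) + - (s / p)"
  proof -
    have "1 / p - 1 = (1 - p) / p" using p by (simp add: diff_divide_distrib)
    also have "1 - p = - s + - s" by (simp add: p_def)
    finally show ?thesis by (simp add: add_divide_distrib)
  qed
  also have "4 * q powr \<dots> = (2 * \<rho>)\<^sup>2"
    by (simp only: powr_add \<rho> power2_eq_square)
  finally show "2 ^ (J_star s n + 1) * (ln n / n) \<le> (2 * \<rho>)\<^sup>2"
    by (simp add: J_def)
qed

section \<open>The approximation semi-norm\<close>

text \<open>The smallest admissible constant exists: the infimum of the admissible constants is admissible.\<close>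

lemma approx_bound_seminorm:
  assumes "f \<in> approx_space \<Psi> P s"
  shows "approx_bound \<Psi> P s f (approx_seminorm \<Psi> P s f)"
proof -
  define S where "S = {M0. approx_bound \<Psi> P s f M0}"
  have ne: "S \<noteq> {}" using assms by (auto simp: S_def approx_space_def)
  have bdd: "bdd_below S" by (auto simp: S_def approx_bound_def intro!: bdd_belowI[of _ 0])
  have "approx_bound \<Psi> P s f (Inf S)"
    unfolding approx_bound_def
  proof (intro conjI allI)
    show "0 \<le> Inf S"
      using ne by (intro cInf_greatest) (auto simp: S_def approx_bound_def)
    fix J
    let ?e = "L2_norm (law_X P) (\<lambda>x. f x - projection \<Psi> P (uniform_tree J) f x)"
    have "?e / 2 powr (- real J * s) \<le> Inf S"
      using ne by (intro cInf_greatest) (auto simp: S_def approx_bound_def pos_divide_le_eq)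
    then show "?e \<le> Inf S * 2 powr (- real J * s)"
      by (simp add: pos_divide_le_eq)
  qed
  moreover have "Inf S \<le> M0" if "approx_bound \<Psi> P s f M0" for M0
    using that bdd by (intro cInf_lower) (auto simp: S_def)
  ultimately have "approx_seminorm \<Psi> P s f = Inf S"
    unfolding approx_seminorm_def by (rule Least_equality)
  with \<open>approx_bound \<Psi> P s f (Inf S)\<close> show ?thesis by simp
qed

section \<open>Indices up to a level\<close>

text \<open>
  The indices that occur in the projection on, and the estimator for, the uniform partition of
  level \<open>J\<close>: the scaling function, at level \<open>-1\<close>, and all wavelets of levels \<open>0\<close> to \<open>J\<close>
  (the nodes of the tree and its outer leaves).
\<close>

definition level_indices :: "nat \<Rightarrow> (int \<times> nat) set" where
  "level_indices J = insert (- 1, 0) ((\<lambda>(j, k). (int j, k)) ` {\<nu> \<in> nodes. fst \<nu> \<le> J})"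

lemma nodes_up_to_level: "{\<nu> \<in> nodes. fst \<nu> \<le> J} = (SIGMA j:{..J}. {..<2 ^ j})"
  by (auto simp: nodes_def)

lemma inj_on_level_index: "inj_on (\<lambda>(j, k). (int j, k)) A"
  by (auto simp: inj_on_def)

lemma finite_level_indices: "finite (level_indices J)"
  unfolding level_indices_def nodes_up_to_level by simp

lemma card_level_indices: "card (level_indices J) = 2 ^ (J + 1)"
proof -
  have "(\<Sum>j\<le>J. 2 ^ j :: nat) = 2 ^ (J + 1) - 1"
    by (induction J) auto
  then have "card (SIGMA j:{..J}. {..<2 ^ j :: nat}) = 2 ^ (J + 1) - 1"
    by (simp add: card_SigmaI)
  then have "card ((\<lambda>(j, k). (int j, k)) ` {\<nu> \<in> nodes. fst \<nu> \<le> J}) = 2 ^ (J + 1) - 1"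
    unfolding nodes_up_to_level using inj_on_level_index by (subst card_image) auto
  then show ?thesis
    unfolding level_indices_def
    by (subst card_insert_disjoint) (auto simp: nodes_up_to_level)
qed

lemma level_indices_subset: "level_indices J \<subseteq> wavelet_indices"
  by (auto simp: level_indices_def wavelet_indices_def)

lemma uniform_tree_Un_leaves:
  "uniform_tree J \<union> outer_leaves (uniform_tree J) = {\<nu> \<in> nodes. fst \<nu> \<le> J}"
  by (auto simp: outer_leaves_uniform_tree) (auto simp: uniform_tree_def)

text \<open>The warped wavelets \<open>\<psi>\<^sub>j\<^sub>,\<^sub>k(G)\<close>, indexed by pairs.\<close>

definition warped :: "(int \<Rightarrow> nat \<Rightarrow> real \<Rightarrow> real) \<Rightarrow> (real \<times> real) measure \<Rightarrow> int \<times> nat \<Rightarrow> real \<Rightarrow> real"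
  where "warped \<Psi> P i x = \<Psi> (fst i) (snd i) (G_X P x)"

lemma sum_level_indices:
  "(\<Sum>i\<in>level_indices J. F i) = F (- 1, 0)
    + (\<Sum>(j, k)\<in>uniform_tree J \<union> outer_leaves (uniform_tree J). F (int j, k))"
  for F :: "int \<times> nat \<Rightarrow> real"
proof -
  have "(\<Sum>i\<in>(\<lambda>(j, k). (int j, k)) ` {\<nu> \<in> nodes. fst \<nu> \<le> J}. F i)
      = (\<Sum>(j, k)\<in>{\<nu> \<in> nodes. fst \<nu> \<le> J}. F (int j, k))"
    by (subst sum.reindex[OF inj_on_level_index]) (simp add: case_prod_unfold)
  then show ?thesis
    unfolding level_indices_def uniform_tree_Un_leaves
    by (subst sum.insert) (auto simp: nodes_up_to_level)
qed

lemma projection_uniform: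
  "projection \<Psi> P (uniform_tree J) f x
    = (\<Sum>i\<in>level_indices J. coeff \<Psi> P f (fst i) (snd i) * warped \<Psi> P i x)"
  by (simp add: projection_def sum_level_indices warped_def)

lemma estimator_uniform:
  "estimator \<Psi> P n (uniform_tree J) z x
    = (\<Sum>i\<in>level_indices J. emp_coeff \<Psi> P n z (fst i) (snd i) * warped \<Psi> P i x)"
  by (simp add: estimator_def sum_level_indices warped_def)

text \<open>
  One constant serves the wavelets, through \<open>\<parallel>\<psi>\<parallel>\<^sub>\<infinity>\<close>, and the scaling function.
\<close>

lemma wavelet_basis_level_bound:
  assumes "unit_interval_wavelet_basis \<phi> \<psi> \<Psi>"
  shows "\<exists>K>0. \<forall>J. \<forall>i\<in>level_indices J. \<forall>x\<in>{0..1}.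
    \<bar>\<Psi> (fst i) (snd i) x\<bar> \<le> K * 2 powr (real J / 2)"
proof -
  have "bounded (\<Psi> (- 1) 0 ` {0..1})"
    using assms by (simp add: unit_interval_wavelet_basis_def)
  then obtain K0 where K0: "\<And>x. x \<in> {0..1} \<Longrightarrow> \<bar>\<Psi> (- 1) 0 x\<bar> \<le> K0"
    unfolding bounded_iff by (metis imageI real_norm_def)
  define S where "S = (SUP y. \<bar>\<psi> y\<bar>)"
  have S: "\<bar>\<Psi> (int j) k x\<bar> \<le> 2 powr (real j / 2) * S" if "(j, k) \<in> nodes" "x \<in> {0..1}" for j k x
    using assms that by (auto simp: unit_interval_wavelet_basis_def S_def)
  define K where "K = max 1 (max K0 S)"
  show ?thesis
  proof (intro exI[of _ K] conjI allI ballI)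
    show "0 < K" by (simp add: K_def)
    fix J i and x :: real assume i: "i \<in> level_indices J" and x: "x \<in> {0..1}"
    consider "i = (- 1, 0)" | j k where "i = (int j, k)" "(j, k) \<in> nodes" "j \<le> J"
      using i by (auto simp: level_indices_def)
    then show "\<bar>\<Psi> (fst i) (snd i) x\<bar> \<le> K * 2 powr (real J / 2)"
    proof cases
      case 1
      then have "\<bar>\<Psi> (fst i) (snd i) x\<bar> \<le> K * 1"
        using K0[OF x] by (simp add: K_def)
      also have "\<dots> \<le> K * 2 powr (real J / 2)"
        by (intro mult_left_mono) (auto simp: K_def ge_one_powr_ge_zero)
      finally show ?thesis .
    next
      case 2
      then have "\<bar>\<Psi> (fst i) (snd i) x\<bar> \<le> 2 powr (real j / 2) * S"
        using S x by simp
      also have "\<dots> \<le> 2 powr (real j / 2) * K"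
        by (intro mult_left_mono) (auto simp: K_def)
      also have "\<dots> \<le> 2 powr (real J / 2) * K"
        using 2 by (intro mult_right_mono) (auto simp: K_def)
      finally show ?thesis by (simp add: mult.commute)
    qed
  qed
qed

section \<open>The warped system in the regression model\<close>

context
  fixes M :: real and P :: "(real \<times> real) measure" and f :: "real \<Rightarrow> real"
  assumes model: "regression_model M P f"
begin

interpretation P: prob_space P
  using model by (simp add: regression_model_def)

lemma sets_model [measurable_cong]: "sets P = sets (borel \<Otimes>\<^sub>M borel)"
  unfolding borel_prod using model by (simp add: regression_model_def)

lemma cdf_distribution_law_X: "cdf_distribution (law_X P)"
  unfolding law_X_def cdf_distribution_def by (rule P.real_distribution_distr) measurable

interpretation X: cdf_distribution "law_X P"
  by (rule cdf_distribution_law_X)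

lemma distr_G_X_uniform:
  "distr (law_X P) (restrict_space lborel {0..1}) (G_X P) = restrict_space lborel {0..1}"
  using model X.distr_cdf_uniform by (simp add: regression_model_def G_X_def)

lemma measurable_G_X: "G_X P \<in> measurable (law_X P) (restrict_space lborel {0..1})"
  unfolding G_X_def by (rule X.measurable_cdf_unit)

lemma G_X_unit: "G_X P x \<in> {0..1}"
  by (simp add: G_X_def X.cdf_nonneg X.cdf_bounded_prob)

lemma integrable_G_X:
  fixes h :: "real \<Rightarrow> real"
  assumes "h \<in> borel_measurable (restrict_space lborel {0..1})"
  shows "integrable (law_X P) (\<lambda>x. h (G_X P x)) \<longleftrightarrow> integrable (restrict_space lborel {0..1}) h"
  using integrable_distr_eq[OF measurable_G_X assms] by (simp add: distr_G_X_uniform)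

lemma integral_G_X:
  fixes h :: "real \<Rightarrow> real"
  assumes "h \<in> borel_measurable (restrict_space lborel {0..1})"
  shows "(\<integral>x. h (G_X P x) \<partial>law_X P) = (\<integral>u. h u \<partial>restrict_space lborel {0..1})"
  using integral_distr[OF measurable_G_X assms] by (simp add: distr_G_X_uniform)

lemma warped_L2:
  assumes "unit_interval_wavelet_basis \<phi> \<psi> \<Psi>" and "i \<in> wavelet_indices"
  shows "warped \<Psi> P i \<in> L2 (law_X P)"
proof -
  have "(case i of (j, k) \<Rightarrow> \<Psi> j k) \<in> L2 (restrict_space lborel {0..1})"
    using assms unfolding unit_interval_wavelet_basis_def orthonormal_basis_L2_def by blast
  then have \<Psi>: "\<Psi> (fst i) (snd i) \<in> L2 (restrict_space lborel {0..1})"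
    by (simp add: case_prod_unfold)
  then have m: "\<Psi> (fst i) (snd i) \<in> borel_measurable (restrict_space lborel {0..1})"
    by (simp add: L2_def)
  have "warped \<Psi> P i \<in> borel_measurable (law_X P)"
    unfolding warped_def[abs_def] by (rule measurable_compose[OF measurable_G_X m])
  moreover have "integrable (law_X P) (\<lambda>x. (warped \<Psi> P i x)\<^sup>2)"
    unfolding warped_def using \<Psi> m
    by (subst integrable_G_X[of "\<lambda>u. (\<Psi> (fst i) (snd i) u)\<^sup>2"]) (auto simp: L2_def)
  ultimately show ?thesis by (simp add: L2_def)
qed

lemma warped_orthonormal:
  assumes basis: "unit_interval_wavelet_basis \<phi> \<psi> \<Psi>"
    and i: "i \<in> wavelet_indices" and k: "k \<in> wavelet_indices"
  shows "(\<integral>x. warped \<Psi> P i x * warped \<Psi> P k x \<partial>law_X P) = (if i = k then 1 else 0)"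
proof -
  have ob: "orthonormal_basis_L2 (restrict_space lborel {0..1}) wavelet_indices (\<lambda>i. \<Psi> (fst i) (snd i))"
    using basis by (simp add: unit_interval_wavelet_basis_def case_prod_unfold)
  have [measurable]: "\<Psi> (fst i) (snd i) \<in> borel_measurable (restrict_space lborel {0..1})"
    if "i \<in> wavelet_indices" for i
    using ob that by (auto simp: orthonormal_basis_L2_def L2_def)
  have "(\<integral>x. warped \<Psi> P i x * warped \<Psi> P k x \<partial>law_X P)
      = (\<integral>u. \<Psi> (fst i) (snd i) u * \<Psi> (fst k) (snd k) u \<partial>restrict_space lborel {0..1})"
    unfolding warped_def using i k
    by (intro integral_G_X[of "\<lambda>u. \<Psi> (fst i) (snd i) u * \<Psi> (fst k) (snd k) u"]) measurable
  then show ?thesis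
    using ob i k by (simp add: orthonormal_basis_L2_def)
qed

lemma estimation_error_pythagoras:
  fixes s :: real and n :: nat
  assumes basis: "unit_interval_wavelet_basis \<phi> \<psi> \<Psi>" and f: "f \<in> L2 (law_X P)"
  defines "J \<equiv> J_star s n"
  shows "(estimation_error \<Psi> P f s n z)\<^sup>2
    = (L2_norm (law_X P) (\<lambda>x. f x - projection \<Psi> P (uniform_tree J) f x))\<^sup>2
      + (\<Sum>i\<in>level_indices J.
          (emp_coeff \<Psi> P n z (fst i) (snd i) - coeff \<Psi> P f (fst i) (snd i))\<^sup>2)"
proof -
  \<comment> \<open>The expansion is used twice: with the empirical and with the true coefficients.\<close>
  have exp_sq: "(\<integral>x. (f x - (\<Sum>i\<in>level_indices J. a i * warped \<Psi> P i x))\<^sup>2 \<partial>law_X P)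
      = (\<integral>x. (f x)\<^sup>2 \<partial>law_X P)
        - 2 * (\<Sum>i\<in>level_indices J. a i * coeff \<Psi> P f (fst i) (snd i))
        + (\<Sum>i\<in>level_indices J. (a i)\<^sup>2)" for a
  proof -
    have e: "warped \<Psi> P i \<in> L2 (law_X P)" if "i \<in> level_indices J" for i
      using warped_L2[OF basis] that level_indices_subset by blast
    have o: "(\<integral>x. warped \<Psi> P i x * warped \<Psi> P k x \<partial>law_X P) = (if i = k then 1 else 0)"
      if "i \<in> level_indices J" "k \<in> level_indices J" for i k
      using warped_orthonormal[OF basis] that level_indices_subset by blast
    show ?thesis
      using integral_square_diff_orthonormal[OF finite_level_indices f e o]
      by (simp add: coeff_def warped_def)
  qed
  have norm_sq: "(L2_norm (law_X P) g)\<^sup>2 = (\<integral>x. (g x)\<^sup>2 \<partial>law_X P)" for g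
    by (simp add: L2_norm_def)
  show ?thesis
    unfolding estimation_error_def norm_sq J_def[symmetric] projection_uniform estimator_uniform
      exp_sq
    unfolding power2_diff sum.distrib sum_subtractf
    by (simp add: sum_distrib_left power2_eq_square mult_ac)
qed

lemma regression_integral:
  assumes e[measurable]: "e \<in> borel_measurable borel" and B: "\<And>x. \<bar>e x\<bar> \<le> B"
  shows "(\<integral>z. snd z * e (fst z) \<partial>P) = (\<integral>x. f x * e x \<partial>law_X P)"
proof -
  define F where "F = vimage_algebra (space P) fst (borel :: real measure)"
  have fm[measurable]: "f \<in> borel_measurable borel"
    and cond: "AE z in P. real_cond_exp P F snd z = f (fst z)"
    using model by (auto simp: regression_model_def regression_function_def F_def)
  have sub: "subalgebra P F"
    unfolding subalgebra_def F_def
    by (auto simp: sets_vimage_algebra2 intro!: measurable_sets[of fst P borel])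
  interpret F: finite_measure_subalgebra P F
    using sub by unfold_locales
  have [measurable]: "(\<lambda>z. e (fst z)) \<in> borel_measurable F"
    unfolding F_def by (intro measurable_compose[OF measurable_vimage_algebra1 e]) auto
  have int: "integrable P (\<lambda>z. e (fst z) * snd z)"
  proof (rule P.integrable_const_bound[of _ "B * M"])
    have "AE z in P. \<bar>snd z\<bar> \<le> M"
      using model by (auto simp: regression_model_def elim!: eventually_mono)
    then show "AE z in P. norm (e (fst z) * snd z) \<le> B * M"
    proof eventually_elim
      case (elim z)
      then have "\<bar>e (fst z)\<bar> * \<bar>snd z\<bar> \<le> B * M"
        using B[of "fst z"] by (intro mult_mono) auto
      then show ?case by (simp add: abs_mult)
    qed
  qed measurable
  have "(\<integral>z. snd z * e (fst z) \<partial>P) = (\<integral>z. e (fst z) * real_cond_exp P F snd z \<partial>P)"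
    using F.real_cond_exp_intg(2)[OF int] by (simp add: mult.commute)
  also have "\<dots> = (\<integral>z. f (fst z) * e (fst z) \<partial>P)"
    using cond by (intro integral_cong_AE) (auto elim!: eventually_mono)
  also have "\<dots> = (\<integral>x. f x * e x \<partial>law_X P)"
    unfolding law_X_def by (subst integral_distr) auto
  finally show ?thesis .
qed

text \<open>
  What the sample mean bounds require of the summands of an empirical coefficient.
\<close>

lemma empirical_coeff:
  assumes basis: "unit_interval_wavelet_basis \<phi> \<psi> \<Psi>" and i: "i \<in> level_indices J"
    and K: "\<forall>x\<in>{0..1}. \<bar>\<Psi> (fst i) (snd i) x\<bar> \<le> K"
  defines "h \<equiv> \<lambda>z. snd z * warped \<Psi> P i (fst z)"
  shows "h \<in> borel_measurable P"
    and "AE z in P. \<bar>h z\<bar> \<le> M * K"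
    and "integrable P (\<lambda>z. (h z)\<^sup>2)"
    and "(\<integral>z. (h z)\<^sup>2 \<partial>P) \<le> M\<^sup>2"
    and "(\<integral>z. h z \<partial>P) = coeff \<Psi> P f (fst i) (snd i)"
    and "emp_coeff \<Psi> P n z (fst i) (snd i) = (\<Sum>l<n. h (z l)) / n"
proof -
  have iw: "i \<in> wavelet_indices" using i level_indices_subset by blast
  have wL2: "warped \<Psi> P i \<in> L2 (law_X P)"
    using basis iw by (rule warped_L2)
  then have wm[measurable]: "warped \<Psi> P i \<in> borel_measurable borel"
    by (simp add: L2_def law_X_def)
  have wK: "\<bar>warped \<Psi> P i x\<bar> \<le> K" for x
    unfolding warped_def using K G_X_unit by (rule bspec)
  show hm[measurable]: "h \<in> borel_measurable P" unfolding h_def by measurable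
  have Y: "AE z in P. \<bar>snd z\<bar> \<le> M"
    using model by (auto simp: regression_model_def elim!: eventually_mono)
  then show hB: "AE z in P. \<bar>h z\<bar> \<le> M * K"
  proof eventually_elim
    case (elim z)
    then show ?case
      unfolding h_def abs_mult using wK[of "fst z"] by (intro mult_mono) auto
  qed
  show h2: "integrable P (\<lambda>z. (h z)\<^sup>2)"
    using hB by (intro P.integrable_const_bound[of _ "(M * K)\<^sup>2"])
      (auto simp: abs_le_square_iff[symmetric] elim!: eventually_mono)
  have w2: "integrable P (\<lambda>z. (warped \<Psi> P i (fst z))\<^sup>2)"
    by (intro P.integrable_const_bound[of _ "K\<^sup>2"])
      (auto simp: abs_le_square_iff[symmetric] intro!: AE_I2 order_trans[OF wK abs_ge_self])
  have "(\<integral>z. (h z)\<^sup>2 \<partial>P) \<le> (\<integral>z. M\<^sup>2 * (warped \<Psi> P i (fst z))\<^sup>2 \<partial>P)"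
  proof (rule integral_mono_AE)
    show "AE z in P. (h z)\<^sup>2 \<le> M\<^sup>2 * (warped \<Psi> P i (fst z))\<^sup>2"
      using Y
    proof eventually_elim
      case (elim z)
      then have "(snd z)\<^sup>2 \<le> M\<^sup>2" by (simp add: abs_le_square_iff[symmetric])
      then show ?case by (simp add: h_def power_mult_distrib mult_right_mono)
    qed
  qed (use h2 w2 in auto)
  also have "\<dots> = M\<^sup>2 * (\<integral>x. (warped \<Psi> P i x)\<^sup>2 \<partial>law_X P)"
    unfolding law_X_def by (subst integral_distr) auto
  also have "\<dots> = M\<^sup>2"
    using warped_orthonormal[OF basis iw iw] by (simp add: power2_eq_square)
  finally show "(\<integral>z. (h z)\<^sup>2 \<partial>P) \<le> M\<^sup>2" .
  show "(\<integral>z. h z \<partial>P) = coeff \<Psi> P f (fst i) (snd i)"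
    using regression_integral[OF wm wK] by (simp add: h_def coeff_def warped_def)
  show "emp_coeff \<Psi> P n z (fst i) (snd i) = (\<Sum>l<n. h (z l)) / n"
    by (simp add: emp_coeff_def h_def warped_def)
qed

end

section \<open>Bias, variance and deviation\<close>

lemma log_rate_square:
  fixes n :: nat and s :: real
  shows "((ln n / n) powr (s / (2 * s + 1)))\<^sup>2 = (ln n / n) powr (2 * s / (2 * s + 1))"
  by (simp add: power2_eq_square powr_add[symmetric] add_divide_distrib[symmetric])

lemma bias_bound:
  fixes n :: nat and s :: real
  assumes f: "f \<in> approx_space \<Psi> P s" and s: "0 < s" and n: "2 \<le> n"
  shows "0 \<le> approx_seminorm \<Psi> P s f"
    and "L2_norm (law_X P) (\<lambda>x. f x - projection \<Psi> P (uniform_tree (J_star s n)) f x)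
      \<le> approx_seminorm \<Psi> P s f * (ln n / n) powr (s / (2 * s + 1))"
proof -
  note b = approx_bound_seminorm[OF f, unfolded approx_bound_def]
  show b0: "0 \<le> approx_seminorm \<Psi> P s f" using b by simp
  have "L2_norm (law_X P) (\<lambda>x. f x - projection \<Psi> P (uniform_tree (J_star s n)) f x)
      \<le> approx_seminorm \<Psi> P s f * 2 powr (- real (J_star s n) * s)"
    using b by blast
  also have "\<dots> \<le> approx_seminorm \<Psi> P s f * (ln n / n) powr (s / (2 * s + 1))"
    using J_star_bounds(1)[OF s n] b0 by (rule mult_left_mono)
  finally show "L2_norm (law_X P) (\<lambda>x. f x - projection \<Psi> P (uniform_tree (J_star s n)) f x)
      \<le> approx_seminorm \<Psi> P s f * (ln n / n) powr (s / (2 * s + 1))" .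
qed

lemma L2_norm_nonneg: "0 \<le> L2_norm N g"
  by (simp add: L2_norm_def integral_nonneg_AE)

lemma expected_error_bound:
  fixes n :: nat and s :: real
  assumes basis: "unit_interval_wavelet_basis \<phi> \<psi> \<Psi>" and model: "regression_model M P f"
    and f: "f \<in> approx_space \<Psi> P s" and s: "0 < s" and n: "2 \<le> n"
  shows "(\<integral>\<^sup>+ z. ennreal ((estimation_error \<Psi> P f s n z)\<^sup>2) \<partial>sample_law P n)
    \<le> ennreal ((4 * M\<^sup>2 / ln 2 + (approx_seminorm \<Psi> P s f)\<^sup>2)
        * (ln n / n) powr (2 * s / (2 * s + 1)))"
proof -
  have P: "prob_space P" using model by (simp add: regression_model_def)
  interpret L: prob_space "sample_law P n" by (rule prob_space_sample_law[OF P])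
  define J where "J = J_star s n"
  define \<rho> where "\<rho> = (ln n / n) powr (s / (2 * s + 1))"
  define A where "A = approx_seminorm \<Psi> P s f"
  define b where "b = L2_norm (law_X P) (\<lambda>x. f x - projection \<Psi> P (uniform_tree J) f x)"
  define D where "D i z = (emp_coeff \<Psi> P n z (fst i) (snd i) - coeff \<Psi> P f (fst i) (snd i))\<^sup>2" for i z
  obtain K where "0 < K" and K: "\<forall>J. \<forall>i\<in>level_indices J. \<forall>x\<in>{0..1}.
      \<bar>\<Psi> (fst i) (snd i) x\<bar> \<le> K * 2 powr (real J / 2)"
    using wavelet_basis_level_bound[OF basis] by blast
  have D: "integrable (sample_law P n) (D i) \<and> (\<integral>z. D i z \<partial>sample_law P n) \<le> M\<^sup>2 / n"
    if i: "i \<in> level_indices J" for i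
  proof -
    have "\<forall>x\<in>{0..1}. \<bar>\<Psi> (fst i) (snd i) x\<bar> \<le> K * 2 powr (real J / 2)"
      using K i by blast
    note h = empirical_coeff[OF model basis i this]
    note v = sample_mean_variance[OF P h(1,3), where n=n, unfolded h(5)]
    have "integrable (sample_law P n) (D i)"
      unfolding D_def[abs_def] h(6)[of n] using v(1) n by simp
    moreover have "(\<integral>z. D i z \<partial>sample_law P n)
        \<le> (\<integral>z. (snd z * warped \<Psi> P i (fst z))\<^sup>2 \<partial>P) / n"
      unfolding D_def h(6)[of n] using v(2) n by simp
    moreover have "\<dots> \<le> M\<^sup>2 / n"
      using h(4) by (intro divide_right_mono) auto
    ultimately show ?thesis by linarith
  qed
  have err: "(estimation_error \<Psi> P f s n z)\<^sup>2 = b\<^sup>2 + (\<Sum>i\<in>level_indices J. D i z)" for z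
    unfolding b_def D_def J_def using f
    by (intro estimation_error_pythagoras[OF model basis]) (simp add: approx_space_def)
  have int: "integrable (sample_law P n) (\<lambda>z. b\<^sup>2 + (\<Sum>i\<in>level_indices J. D i z))"
    using D by (intro Bochner_Integration.integrable_add Bochner_Integration.integrable_sum) auto
  have "b \<le> A * \<rho>" and "0 \<le> b"
    using bias_bound(2)[OF f s n] by (simp_all add: b_def A_def \<rho>_def J_def L2_norm_nonneg)
  then have bias: "b\<^sup>2 \<le> A\<^sup>2 * \<rho>\<^sup>2"
    by (metis power_mono power_mult_distrib)
  have "ln 2 \<le> ln (real n)" using n by simp
  then have "1 / ln (real n) \<le> 1 / ln 2" using n by (intro divide_left_mono) auto
  have "(\<integral>z. (\<Sum>i\<in>level_indices J. D i z) \<partial>sample_law P n)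
      = (\<Sum>i\<in>level_indices J. \<integral>z. D i z \<partial>sample_law P n)"
    using D by (intro Bochner_Integration.integral_sum) auto
  also have "\<dots> \<le> (\<Sum>i\<in>level_indices J. M\<^sup>2 / n)"
    using D by (intro sum_mono) auto
  also have "\<dots> = 2 ^ (J + 1) * (ln n / n) * M\<^sup>2 * (1 / ln n)"
    using n by (simp add: card_level_indices)
  also have "\<dots> \<le> (2 * \<rho>)\<^sup>2 * M\<^sup>2 * (1 / ln 2)"
    using J_star_bounds(3)[OF s n] \<open>1 / ln (real n) \<le> 1 / ln 2\<close> n
    by (intro mult_mono mult_right_mono) (auto simp: J_def \<rho>_def)
  finally have var: "(\<integral>z. (\<Sum>i\<in>level_indices J. D i z) \<partial>sample_law P n) \<le> 4 * M\<^sup>2 / ln 2 * \<rho>\<^sup>2"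
    by (simp add: power_mult_distrib mult_ac)
  have "(\<integral>\<^sup>+ z. ennreal ((estimation_error \<Psi> P f s n z)\<^sup>2) \<partial>sample_law P n)
      = ennreal (\<integral>z. b\<^sup>2 + (\<Sum>i\<in>level_indices J. D i z) \<partial>sample_law P n)"
    unfolding err by (intro nn_integral_eq_integral int AE_I2) (auto simp: D_def intro!: add_nonneg_nonneg sum_nonneg)
  also have "(\<integral>z. b\<^sup>2 + (\<Sum>i\<in>level_indices J. D i z) \<partial>sample_law P n)
      = b\<^sup>2 + (\<integral>z. (\<Sum>i\<in>level_indices J. D i z) \<partial>sample_law P n)"
    using D by (subst Bochner_Integration.integral_add) (auto simp: L.prob_space)
  also have "ennreal \<dots> \<le> ennreal ((4 * M\<^sup>2 / ln 2 + A\<^sup>2) * \<rho>\<^sup>2)"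
    using bias var by (intro ennreal_leI) (simp add: algebra_simps)
  finally show ?thesis
    unfolding A_def \<rho>_def log_rate_square .
qed

text \<open>
  The constant \<open>t\<close> is chosen small enough for \<open>r = t \<surd>(log n / n)\<close> to be an admissible Chernoff
  parameter at all levels up to \<open>J\<close>; then \<open>c\<close> is the value for which the exponent
  \<open>t (t M\<^sup>2 - c)\<close> equals \<open>-(\<beta> + 1)\<close>.
\<close>

lemma error_tail_bound:
  fixes n :: nat and s \<beta> K M :: real
  assumes basis: "unit_interval_wavelet_basis \<phi> \<psi> \<Psi>" and M: "0 < M" and K0: "0 < K"
    and K: "\<forall>J. \<forall>i\<in>level_indices J. \<forall>x\<in>{0..1}.
      \<bar>\<Psi> (fst i) (snd i) x\<bar> \<le> K * 2 powr (real J / 2)"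
    and model: "regression_model M P f"
    and f: "f \<in> approx_space \<Psi> P s" and s: "0 < s" and n: "2 \<le> n"
    and \<beta>: "0 < \<beta>"
  defines "t \<equiv> 1 / (2 * M * K)"
  defines "c \<equiv> (\<beta> + 1) / t + t * M\<^sup>2"
  shows "measure (sample_law P n)
      {z \<in> space (sample_law P n). estimation_error \<Psi> P f s n z >
        (2 * c + approx_seminorm \<Psi> P s f) * (ln n / n) powr (s / (2 * s + 1))}
    \<le> 8 / ln 2 * n powr (- \<beta>)"
proof -
  have P: "prob_space P" using model by (simp add: regression_model_def)
  interpret L: prob_space "sample_law P n" by (rule prob_space_sample_law[OF P])
  define J where "J = J_star s n"
  define \<rho> where "\<rho> = (ln n / n) powr (s / (2 * s + 1))"
  define A where "A = approx_seminorm \<Psi> P s f"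
  define b where "b = L2_norm (law_X P) (\<lambda>x. f x - projection \<Psi> P (uniform_tree J) f x)"
  define D where "D i z = emp_coeff \<Psi> P n z (fst i) (snd i) - coeff \<Psi> P f (fst i) (snd i)" for i z
  define \<delta> where "\<delta> = sqrt (ln n / n)"
  define Bad where "Bad i = {z \<in> space (sample_law P n). \<bar>D i z\<bar> \<ge> c * \<delta>}" for i
  have t: "0 < t" using M K0 by (simp add: t_def)
  have c: "0 < c" using t \<beta> by (simp add: c_def add_pos_nonneg)
  have ln_pos: "0 < ln (real n)" and n_pos: "0 < n" using n by auto
  have \<delta>: "0 < \<delta>" "\<delta>\<^sup>2 = ln n / n" using ln_pos n_pos by (simp_all add: \<delta>_def)
  have "2 ^ J * \<delta>\<^sup>2 \<le> 2 * (n / ln n) * \<delta>\<^sup>2"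
    using J_star_bounds(2)[OF s n] by (intro mult_right_mono) (auto simp: J_def)
  also have "\<dots> = 2" using ln_pos n_pos by (simp add: \<delta>)
  also have "\<dots> \<le> 2\<^sup>2" by simp
  finally have "(2 powr (real J / 2) * \<delta>)\<^sup>2 \<le> 2\<^sup>2"
    by (simp add: power_mult_distrib powr_power powr_realpow)
  then have level: "2 powr (real J / 2) * \<delta> \<le> 2"
    by (rule power2_le_imp_le) simp
  have prob_Bad: "L.prob (Bad i) \<le> 2 * n powr (- (\<beta> + 1))" and meas_Bad: "Bad i \<in> L.events"
    if i: "i \<in> level_indices J" for i
  proof -
    have "\<forall>x\<in>{0..1}. \<bar>\<Psi> (fst i) (snd i) x\<bar> \<le> K * 2 powr (real J / 2)"
      using K i by blast
    note h = empirical_coeff[OF model basis i this]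
    have "(t * \<delta>) * (M * (K * 2 powr (real J / 2))) = (t * M * K) * (2 powr (real J / 2) * \<delta>)"
      by (simp add: mult_ac)
    also have "\<dots> = (1 / 2) * (2 powr (real J / 2) * \<delta>)"
      using M K0 by (simp add: t_def)
    also have "\<dots> \<le> 1" using level by simp
    finally have r: "(t * \<delta>) * (M * (K * 2 powr (real J / 2))) \<le> 1" .
    have "L.prob (Bad i) \<le> 2 * exp (n * ((t * \<delta>)\<^sup>2 * M\<^sup>2 - (t * \<delta>) * (c * \<delta>)))"
      using sample_mean_tail[OF P h(1,2,4) _ r n_pos, of "c * \<delta>", unfolded h(5)] t \<delta>(1)
      unfolding Bad_def D_def h(6)[of n] by simp
    also have "n * ((t * \<delta>)\<^sup>2 * M\<^sup>2 - (t * \<delta>) * (c * \<delta>)) = (n * \<delta>\<^sup>2) * (t * (t * M\<^sup>2 - c))"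
      by (simp add: power2_eq_square algebra_simps)
    also have "n * \<delta>\<^sup>2 = ln n"
      using n_pos by (simp add: \<delta>)
    also have "t * (t * M\<^sup>2 - c) = - (\<beta> + 1)"
      using t by (simp add: c_def)
    also have "exp (ln n * (- (\<beta> + 1))) = n powr (- (\<beta> + 1))"
      using n_pos by (simp add: powr_def mult.commute)
    finally show "L.prob (Bad i) \<le> 2 * n powr (- (\<beta> + 1))" .
    note h(1)[measurable]
    note measurable_sample_component[OF P, measurable]
    show "Bad i \<in> L.events"
      unfolding Bad_def D_def h(6)[of n] by measurable
  qed
  \<comment> \<open>Off the bad events every coefficient errs by at most \<open>c \<delta>\<close>.\<close>
  have "{z \<in> space (sample_law P n). estimation_error \<Psi> P f s n z > (2 * c + A) * \<rho>}
      \<subseteq> (\<Union>i\<in>level_indices J. Bad i)"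
  proof (rule subsetI, rule ccontr)
    fix z
    assume z: "z \<in> {z \<in> space (sample_law P n). estimation_error \<Psi> P f s n z > (2 * c + A) * \<rho>}"
      and "z \<notin> (\<Union>i\<in>level_indices J. Bad i)"
    then have "\<bar>D i z\<bar> \<le> c * \<delta>" if "i \<in> level_indices J" for i
      using that by (force simp: Bad_def)
    then have "(\<Sum>i\<in>level_indices J. (D i z)\<^sup>2) \<le> (\<Sum>i\<in>level_indices J. (c * \<delta>)\<^sup>2)"
      using c \<delta>(1) by (intro sum_mono) (simp add: abs_le_square_iff[symmetric])
    also have "\<dots> = c\<^sup>2 * (2 ^ (J + 1) * (ln n / n))"
      by (simp add: card_level_indices power_mult_distrib \<delta>(2))
    also have "\<dots> \<le> c\<^sup>2 * (2 * \<rho>)\<^sup>2"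
      using J_star_bounds(3)[OF s n] by (intro mult_left_mono) (auto simp: J_def \<rho>_def)
    finally have stoch: "(\<Sum>i\<in>level_indices J. (D i z)\<^sup>2) \<le> (2 * c * \<rho>)\<^sup>2"
      by (simp add: power_mult_distrib mult_ac)
    have b: "b \<le> A * \<rho>" "0 \<le> b"
      using bias_bound(2)[OF f s n] by (simp_all add: b_def A_def \<rho>_def J_def L2_norm_nonneg)
    have A: "0 \<le> A" and \<rho>: "0 \<le> \<rho>"
      using bias_bound(1)[OF f s n] by (simp_all add: A_def \<rho>_def)
    have "(estimation_error \<Psi> P f s n z)\<^sup>2 = b\<^sup>2 + (\<Sum>i\<in>level_indices J. (D i z)\<^sup>2)"
      unfolding b_def D_def J_def using f
      by (intro estimation_error_pythagoras[OF model basis]) (simp add: approx_space_def)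
    also have "\<dots> \<le> (A * \<rho>)\<^sup>2 + (2 * c * \<rho>)\<^sup>2"
      using b stoch by (intro add_mono power_mono)
    also have "\<dots> \<le> ((2 * c + A) * \<rho>)\<^sup>2"
      using A c \<rho> by (simp add: power2_eq_square algebra_simps)
    finally have "estimation_error \<Psi> P f s n z \<le> (2 * c + A) * \<rho>"
      by (rule power2_le_imp_le) (use A c \<rho> in simp)
    with z show False by simp
  qed
  then have "L.prob {z \<in> space (sample_law P n). estimation_error \<Psi> P f s n z > (2 * c + A) * \<rho>}
      \<le> L.prob (\<Union>i\<in>level_indices J. Bad i)"
    using meas_Bad finite_level_indices by (intro L.finite_measure_mono) auto
  also have "\<dots> \<le> (\<Sum>i\<in>level_indices J. L.prob (Bad i))"
    using meas_Bad finite_level_indices by (intro L.finite_measure_subadditive_finite) auto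
  also have "\<dots> \<le> (\<Sum>i\<in>level_indices J. 2 * n powr (- (\<beta> + 1)))"
    by (intro sum_mono prob_Bad)
  also have "\<dots> = 4 * n powr (- (\<beta> + 1)) * 2 ^ J"
    by (simp add: card_level_indices)
  also have "\<dots> \<le> 4 * n powr (- (\<beta> + 1)) * (2 * (n / ln 2))"
  proof (rule mult_left_mono)
    have "n / ln n \<le> n / ln 2"
      using n by (intro divide_left_mono) auto
    then show "2 ^ J \<le> 2 * (n / ln 2)"
      using J_star_bounds(2)[OF s n] by (simp add: J_def)
  qed simp
  also have "\<dots> = 8 / ln 2 * (n powr (- (\<beta> + 1)) * n powr 1)"
    using n_pos by simp
  also have "\<dots> = 8 / ln 2 * n powr (- \<beta>)"
    by (simp only: powr_add[symmetric]) simp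
  finally show ?thesis by (simp add: A_def \<rho>_def)
qed

theorem theorem2p1:
  fixes \<phi> \<psi> :: "real \<Rightarrow> real" and \<Psi> :: "int \<Rightarrow> nat \<Rightarrow> real \<Rightarrow> real" and M :: real
  assumes "unit_interval_wavelet_basis \<phi> \<psi> \<Psi>" and "0 < M"
  shows "\<exists>C::real. \<forall>\<beta>::real. 0 < \<beta> \<longrightarrow> (\<exists>c::real.
    \<forall>(s::real) (P :: (real \<times> real) measure) (f :: real \<Rightarrow> real).
      0 < s \<and> regression_model M P f \<and> f \<in> approx_space \<Psi> P s \<longrightarrow>
      (\<forall>n::nat. 2 \<le> n \<longrightarrow>
         measure (sample_law P n)
           {z \<in> space (sample_law P n). estimation_error \<Psi> P f s n z >
              (c + approx_seminorm \<Psi> P s f) * (ln (real n) / real n) powr (s / (2 * s + 1))}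
           \<le> C * real n powr (- \<beta>) \<and>
         (\<integral>\<^sup>+ z. ennreal ((estimation_error \<Psi> P f s n z)\<^sup>2) \<partial>sample_law P n)
           \<le> ennreal ((C + (approx_seminorm \<Psi> P s f)\<^sup>2) *
                (ln (real n) / real n) powr (2 * s / (2 * s + 1)))))"
proof -
  obtain K where K: "0 < K" "\<forall>J. \<forall>i\<in>level_indices J. \<forall>x\<in>{0..1}.
      \<bar>\<Psi> (fst i) (snd i) x\<bar> \<le> K * 2 powr (real J / 2)"
    using wavelet_basis_level_bound[OF assms(1)] by blast
  \<comment> \<open>The first summand comes from the union bound, the second from the variances.\<close>
  define C where "C = 8 / ln 2 + 4 * M\<^sup>2 / ln (2::real)"
  define t where "t = 1 / (2 * M * K)"
  show ?thesis
  proof (rule exI[of _ C], intro allI impI,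
      rule_tac x = "2 * ((\<beta> + 1) / t + t * M\<^sup>2)" in exI, intro allI impI conjI; elim conjE)
    fix \<beta> s :: real and P :: "(real \<times> real) measure" and f :: "real \<Rightarrow> real" and n :: nat
    assume \<beta>: "0 < \<beta>" and s: "0 < s" and model: "regression_model M P f"
      and f: "f \<in> approx_space \<Psi> P s" and n: "2 \<le> n"
    have "measure (sample_law P n)
        {z \<in> space (sample_law P n). estimation_error \<Psi> P f s n z >
          (2 * ((\<beta> + 1) / t + t * M\<^sup>2) + approx_seminorm \<Psi> P s f)
            * (ln (real n) / real n) powr (s / (2 * s + 1))}
        \<le> 8 / ln 2 * n powr (- \<beta>)"
      unfolding t_def by (rule error_tail_bound[OF assms K model f s n \<beta>])
    also have "\<dots> \<le> C * n powr (- \<beta>)"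
      by (intro mult_right_mono) (simp_all add: C_def)
    finally show "measure (sample_law P n)
        {z \<in> space (sample_law P n). estimation_error \<Psi> P f s n z >
          (2 * ((\<beta> + 1) / t + t * M\<^sup>2) + approx_seminorm \<Psi> P s f)
            * (ln (real n) / real n) powr (s / (2 * s + 1))}
        \<le> C * n powr (- \<beta>)" .
    have "(\<integral>\<^sup>+ z. ennreal ((estimation_error \<Psi> P f s n z)\<^sup>2) \<partial>sample_law P n)
        \<le> ennreal ((4 * M\<^sup>2 / ln 2 + (approx_seminorm \<Psi> P s f)\<^sup>2)
            * (ln n / n) powr (2 * s / (2 * s + 1)))"
      by (rule expected_error_bound[OF assms(1) model f s n])
    also have "\<dots> \<le> ennreal ((C + (approx_seminorm \<Psi> P s f)\<^sup>2)
            * (ln n / n) powr (2 * s / (2 * s + 1)))"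
      by (intro ennreal_leI mult_right_mono) (simp_all add: C_def)
    finally show "(\<integral>\<^sup>+ z. ennreal ((estimation_error \<Psi> P f s n z)\<^sup>2) \<partial>sample_law P n)
        \<le> ennreal ((C + (approx_seminorm \<Psi> P s f)\<^sup>2)
            * (ln (real n) / real n) powr (2 * s / (2 * s + 1)))" .
  qed
qed

end
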